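(* Let $\mathbb F$ be a field of characteristic not equal to $2$, let $k\ge 1$ be an integer, and let $\mathcal U$ be a vector space over $\mathbb F$ with $\dim_{\mathbb F}\mathcal U=n$, where $n\geq 1$ is an integer. Let $b:\mathcal U\times\mathcal U\to\mathbb F$ be a nondegenerate symmetric bilinear form and let $f_i:\mathcal U\to\mathcal U$, $i=1,\dots,k-1$, be pairwise commuting, symmetric (relative to $b$), diagonalizable endomorphisms. Then the algebra $E(\mathcal U,b,f_1,\dots,f_{k-1})$ is a nilpotent evolution algebra of type $[\underbrace{1,1,\dots,1}_{k},n]$.
   Context: An algebra over a field is not assumed associative or unital. An evolution algebra over a field is an algebra admitting a basis $\{e_i\}$ (a natural basis) such that $e_ie_j=0$ whenever $i\ne j$ (each $e_i^2$ being an arbitrary linear combination of basis elements). For an evolution algebra $E$ put $E^1=E$ and $E^m=\sum_{i=1}^{m-1}E^iE^{m-i}$ for $m\ge2$; $E$ is nilpotent if $E^m=0$ for some $m\in\mathbb N$. For an algebra $\mathcal A$ define $\operatorname{ann}^0(\mathcal A)=0$, $\operatorname{ann}^1(\mathcal A)=\operatorname{ann}(\mathcal A)=\{x\in\mathcal A: x\mathcal A=\mathcal A x=0\}$, and $\operatorname{ann}^i(\mathcal A)$ by $\operatorname{ann}^i(\mathcal A)/\operatorname{ann}^{i-1}(\mathcal A)=\operatorname{ann}(\mathcal A/\operatorname{ann}^{i-1}(\mathcal A))$. If $\mathcal A$ is finite-dimensional and nilpotent and $s$ is the lowest natural number with $\operatorname{ann}^s(\mathcal A)=\mathcal A$, the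 type of $\mathcal A$ is the sequence $[n_1,\dots,n_s]$ with $n_i=\dim_{\mathbb F}\operatorname{ann}^i(\mathcal A)-\dim_{\mathbb F}\operatorname{ann}^{i-1}(\mathcal A)$. An endomorphism $f$ of $\mathcal U$ is symmetric relative to $b$ if $b(f(u),v)=b(u,f(v))$ for all $u,v\in\mathcal U$. The algebra $E(\mathcal U,b,f_1,\dots,f_{k-1})$ is the vector space $\mathcal U\times\underbrace{\mathbb F\times\dots\times\mathbb F}_k$ with multiplication $$(u,\alpha_1,\dots,\alpha_k)(v,\beta_1,\dots,\beta_k)=\bigl(0,\,b(u,v),\,b(f_1(u),v)+\alpha_1\beta_1,\,b(f_2(u),v)+\alpha_2\beta_2,\dots,\,b(f_{k-1}(u),v)+\alpha_{k-1}\beta_{k-1}\bigr)$$ for $u,v\in\mathcal U$ and $\alpha_i,\beta_j\in\mathbb F$. *)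

theory Defs
  imports Complex_Main "HOL-Library.Set_Algebras" "HOL-Library.Function_Algebras"
    "HOL-Library.Product_Plus"
begin

section \<open>Bilinear forms and endomorphisms\<close>

context vector_space
begin

definition symmetric_bilinear_form :: "('b \<Rightarrow> 'b \<Rightarrow> 'a) \<Rightarrow> bool" where
  "symmetric_bilinear_form b \<longleftrightarrow>
     (\<forall>u. Vector_Spaces.linear scale (*) (\<lambda>v. b u v)) \<and>
     (\<forall>v. Vector_Spaces.linear scale (*) (\<lambda>u. b u v)) \<and>
     (\<forall>u v. b u v = b v u)"

text \<open>Only used for symmetric forms, so the radical on one side suffices.\<close>

definition nondegenerate :: "('b \<Rightarrow> 'b \<Rightarrow> 'a) \<Rightarrow> bool" where
  "nondegenerate b \<longleftrightarrow> (\<forall>u. (\<forall>v. b u v = 0) \<longrightarrow> u = 0)"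

definition symmetric_rel :: "('b \<Rightarrow> 'b \<Rightarrow> 'a) \<Rightarrow> ('b \<Rightarrow> 'b) \<Rightarrow> bool" where
  "symmetric_rel b f \<longleftrightarrow> (\<forall>u v. b (f u) v = b u (f v))"

definition diagonalizable :: "('b \<Rightarrow> 'b) \<Rightarrow> bool" where
  "diagonalizable f \<longleftrightarrow>
     (\<exists>B. independent B \<and> span B = UNIV \<and> (\<forall>x\<in>B. \<exists>c. f x = scale c x))"

end


section \<open>Nonassociative algebras and evolution algebras\<close>

text \<open>
  Dimensions that depend on a natural number are needed below, so an algebra is a subspace
  \<open>A\<close> of an ambient vector space, with a multiplication that only matters on \<open>A\<close>.
\<close>

locale nonassoc_algebra = vector_space scale
  for scale :: "'a::field \<Rightarrow> 'b::ab_group_add \<Rightarrow> 'b"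
  and A :: "'b set"
  and mult :: "'b \<Rightarrow> 'b \<Rightarrow> 'b" (infixl \<open>\<cdot>\<close> 70) +
  assumes subspace_carrier: "subspace A"
    and mult_closed: "\<lbrakk>x \<in> A; y \<in> A\<rbrakk> \<Longrightarrow> x \<cdot> y \<in> A"
    and mult_add_left: "\<lbrakk>x \<in> A; y \<in> A; z \<in> A\<rbrakk> \<Longrightarrow> (x + y) \<cdot> z = x \<cdot> z + y \<cdot> z"
    and mult_add_right: "\<lbrakk>x \<in> A; y \<in> A; z \<in> A\<rbrakk> \<Longrightarrow> x \<cdot> (y + z) = x \<cdot> y + x \<cdot> z"
    and mult_scale_left: "\<lbrakk>x \<in> A; y \<in> A\<rbrakk> \<Longrightarrow> scale c x \<cdot> y = scale c (x \<cdot> y)"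
    and mult_scale_right: "\<lbrakk>x \<in> A; y \<in> A\<rbrakk> \<Longrightarrow> x \<cdot> scale c y = scale c (x \<cdot> y)"

locale evolution_algebra = nonassoc_algebra +
  assumes natural_basis:
    "\<exists>B. independent B \<and> span B = A \<and> (\<forall>x\<in>B. \<forall>y\<in>B. x \<noteq> y \<longrightarrow> x \<cdot> y = 0)"

text \<open>
  The annihilator of an algebra with carrier \<open>C\<close>, multiplication \<open>m\<close> and zero \<open>z\<close>; the
  explicit zero allows it to be applied to an algebra of cosets as well.
\<close>

definition annihilator :: "'c set \<Rightarrow> ('c \<Rightarrow> 'c \<Rightarrow> 'c) \<Rightarrow> 'c \<Rightarrow> 'c set" where
  "annihilator C m z = {x \<in> C. \<forall>y\<in>C. m x y = z \<and> m y x = z}"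

context nonassoc_algebra
begin

subsection \<open>Nilpotency\<close>

definition subspace_prod :: "'b set \<Rightarrow> 'b set \<Rightarrow> 'b set" where
  "subspace_prod S T = span {x \<cdot> y | x y. x \<in> S \<and> y \<in> T}"

text \<open>
  The sum in \<open>algebra_power\<close> is the (Minkowski) sum of subspaces.  The value at \<open>0\<close> is a
  dummy, excluded in \<open>nilpotent\<close>.
\<close>

function algebra_power :: "nat \<Rightarrow> 'b set" where
  "algebra_power m =
     (if m \<le> 1 then A
      else (\<Sum>i = 1..m - 1. subspace_prod (algebra_power i) (algebra_power (m - i))))"
  by pat_completeness auto
termination by (relation "measure id") auto

declare algebra_power.simps [simp del]

definition nilpotent :: bool where
  "nilpotent \<longleftrightarrow> (\<exists>m\<ge>1. algebra_power m = {0})"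

subsection \<open>Upper annihilating series and type\<close>

text \<open>The quotient of \<open>A\<close> by an ideal \<open>I\<close>, consisting of the cosets \<open>x +o I\<close>; its zero is \<open>I\<close>.\<close>

definition quotient_carrier :: "'b set \<Rightarrow> 'b set set" where
  "quotient_carrier I = (\<lambda>x. x +o I) ` A"

definition quotient_mult :: "'b set \<Rightarrow> 'b set \<Rightarrow> 'b set \<Rightarrow> 'b set" where
  "quotient_mult I X Y = (\<Union>x\<in>X. \<Union>y\<in>Y. (x \<cdot> y) +o I)"

text \<open>
  \<open>ann_series (Suc i)\<close> is the full preimage in \<open>A\<close> of the annihilator of the quotient of
  \<open>A\<close> by \<open>ann_series i\<close>.
\<close>

primrec ann_series :: "nat \<Rightarrow> 'b set" where
  "ann_series 0 = {0}"
| "ann_series (Suc i) =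
     {x \<in> A. x +o ann_series i \<in>
       annihilator (quotient_carrier (ann_series i)) (quotient_mult (ann_series i)) (ann_series i)}"

lemma ann_series_1: "ann_series 1 = annihilator A mult 0"
  by (auto simp: annihilator_def quotient_carrier_def quotient_mult_def elt_set_plus_def)

lemma ann_series_quotient:
  "(\<lambda>x. x +o ann_series i) ` ann_series (Suc i) =
     annihilator (quotient_carrier (ann_series i)) (quotient_mult (ann_series i)) (ann_series i)"
  by (auto simp: annihilator_def quotient_carrier_def)

definition finite_dimensional :: bool where
  "finite_dimensional \<longleftrightarrow> (\<exists>B. finite B \<and> span B = A)"

text \<open>The subtraction of natural numbers is exact, since the series is ascending.\<close>

definition has_type :: "nat list \<Rightarrow> bool" where
  "has_type ns \<longleftrightarrow> finite_dimensional \<and> nilpotent \<and>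
     (\<exists>s. ann_series s = A \<and> (\<forall>t<s. ann_series t \<noteq> A) \<and>
        ns = map (\<lambda>i. dim (ann_series i) - dim (ann_series (i - 1))) [1..<Suc s])"

end


section \<open>The algebra $E(U,b,f_1,\dots,f_{k-1})$\<close>

text \<open>
  \<open>F\<^sup>k\<close> is represented by the functions \<open>\<alpha> :: nat \<Rightarrow> 'f\<close> that vanish outside \<open>{1..k}\<close>,
  so that \<open>\<alpha> i\<close> is the \<open>i\<close>-th coordinate.
\<close>

definition E_carrier :: "nat \<Rightarrow> ('u \<times> (nat \<Rightarrow> 'f::zero)) set" where
  "E_carrier k = {(u, \<alpha>). \<forall>i. i \<notin> {1..k} \<longrightarrow> \<alpha> i = 0}"

definition E_scale ::
  "('f \<Rightarrow> 'u \<Rightarrow> 'u) \<Rightarrow> 'f::times \<Rightarrow> 'u \<times> (nat \<Rightarrow> 'f) \<Rightarrow> 'u \<times> (nat \<Rightarrow> 'f)" where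
  "E_scale scale c = (\<lambda>(u, \<alpha>). (scale c u, \<lambda>i. c * \<alpha> i))"

definition E_mult ::
  "nat \<Rightarrow> ('u \<Rightarrow> 'u \<Rightarrow> 'f) \<Rightarrow> (nat \<Rightarrow> 'u \<Rightarrow> 'u) \<Rightarrow>
   'u::zero \<times> (nat \<Rightarrow> 'f) \<Rightarrow> 'u \<times> (nat \<Rightarrow> 'f) \<Rightarrow> 'u \<times> (nat \<Rightarrow> 'f::semiring_0)" where
  "E_mult k b f = (\<lambda>(u, \<alpha>) (v, \<beta>).
     (0, \<lambda>i. if i = 1 then b u v
             else if i \<in> {2..k} then b (f (i - 1) u) v + \<alpha> (i - 1) * \<beta> (i - 1)
             else 0))"

end

theory Submission
  imports Defs
begin

text \<open>
  The natural basis comes from simultaneous orthogonal diagonalization.  If a basis \<open>B\<close> of \<open>U\<close>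
  is orthogonal for \<open>b\<close> and consists of common eigenvectors of the \<open>f\<^sub>i\<close>, then not only \<open>b u v\<close>
  but every \<open>b (f\<^sub>i u) v\<close> vanishes for different \<open>u, v \<in> B\<close>, so that \<open>B\<close> together with the
  unit vectors of \<open>F\<^sup>k\<close> is a natural basis.

  To find \<open>B\<close>, note first that the common eigenvectors span \<open>U\<close>
  (\<open>span_common_eigenvectors\<close>): \<open>f\<^sub>j\<close> preserves each joint eigenspace of the other maps, and the
  restriction of a diagonalizable map to an invariant subspace is again diagonalizable
  (\<open>eigenspace_splitting\<close>).  Now take a largest orthogonal set \<open>B\<close> of common eigenvectors \<open>x\<close>
  with \<open>b x x \<noteq> 0\<close>.  Symmetry of the \<open>f\<^sub>i\<close> makes common eigenvectors with different eigenvalues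
  orthogonal, hence the part of a common eigenvector orthogonal to \<open>B\<close> is again a common
  eigenvector (\<open>common_eigenvector_orthogonal_part\<close>).  If \<open>B\<close> did not span \<open>U\<close>, there would be
  such a part \<open>s \<noteq> 0\<close> and, by nondegeneracy, another one \<open>t\<close> with \<open>b s t \<noteq> 0\<close>.  They have the
  same eigenvalues, and as \<open>2 \<noteq> 0\<close> one of \<open>s\<close>, \<open>t\<close>, \<open>s + t\<close> is anisotropic
  (\<open>anisotropic_common_eigenvector\<close>), so it could be added to \<open>B\<close>.

  The algebra is nilpotent because products have no component in \<open>U\<close>, so that \<open>b\<close> contributes
  only to products of two factors, and passing from coordinate \<open>i - 1\<close> to coordinate \<open>i\<close> at most
  doubles the number of factors: coordinate \<open>i\<close> of \<open>E\<^sup>m\<close> vanishes as soon as \<open>m > 2\<^sup>i\<close> (\<open>mult_power_filtration\<close>).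

  For the type, \<open>ann\<^sup>j\<close> with \<open>j \<le> k\<close> is the span of the last \<open>j\<close> unit vectors
  (\<open>ann_series_E\<close>): modulo these, nondegeneracy kills the component in \<open>U\<close> of an annihilating
  element, and multiplication by the \<open>i\<close>-th unit vector moves coordinate \<open>i\<close> to coordinate
  \<open>i + 1\<close>, so that all remaining coordinates but the last one must vanish.  As all products lie in
  \<open>ann\<^sup>k\<close>, the next term is the whole algebra.
\<close>

section \<open>Simultaneous diagonalization\<close>

definition common_eigenvector ::
  "('a \<Rightarrow> 'b \<Rightarrow> 'b) \<Rightarrow> 'i set \<Rightarrow> ('i \<Rightarrow> 'b \<Rightarrow> 'b) \<Rightarrow> 'b \<Rightarrow> bool" where
  "common_eigenvector scale I f v \<longleftrightarrow> (\<forall>i\<in>I. \<exists>c. f i v = scale c v)"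

context vector_space
begin

text \<open>
  The components in \<open>W\<close> are found by induction on the set of eigenvalues: \<open>f w - c w\<close> has no
  component for \<open>c\<close>, so it splits inside \<open>W\<close>.  Dividing its components by the differences \<open>d - c\<close>
  gives \<open>z \<in> W\<close> with \<open>f z - c z = f w - c w\<close>, and \<open>w - z \<in> W\<close> is an eigenvector for \<open>c\<close>.
\<close>

lemma eigenspace_splitting:
  assumes "finite C" and f: "Vector_Spaces.linear scale scale f"
    and W: "subspace W" and inv: "\<And>w. w \<in> W \<Longrightarrow> f w \<in> W"
    and "w \<in> W" and "w \<in> span {v. \<exists>c\<in>C. f v = scale c v}"
  shows "w \<in> span {v \<in> W. \<exists>c\<in>C. f v = scale c v}"
  using assms(1,5,6)
proof (induction C arbitrary: w)
  case empty
  then show ?case by simp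
next
  case (insert c C w)
  interpret f: Vector_Spaces.linear scale scale f by (fact f)
  define V where "V = {v. \<exists>c\<in>C. f v = scale c v}"
  define VW where "VW = {v \<in> W. \<exists>c\<in>C. f v = scale c v}"
  have "{v. \<exists>c\<in>insert c C. f v = scale c v} = V \<union> {v. f v = scale c v}"
    by (auto simp: V_def)
  with insert.prems(2) obtain w' v where w': "w' \<in> span V"
    and v: "v \<in> span {v. f v = scale c v}" and w: "w = w' + v"
    by (auto simp: span_Un)
  have "subspace {v. f v = scale c v}"
    by (auto simp: subspace_def f.add f.scale scale_right_distrib mult.commute)
  then have "span {v. f v = scale c v} = {v. f v = scale c v}" by (simp add: span_eq_iff)
  with v have v: "f v = scale c v" by blast
  have "f w' \<in> span V"
    using w'
  proof (induction rule: span_induct_alt)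
    case base
    show ?case by (simp add: f.zero span_zero)
  next
    case (step a x y)
    obtain d where "f x = scale d x" using step(1) by (auto simp: V_def)
    then have "f x \<in> span V" using step(1) by (simp add: span_scale span_base)
    with step show ?case by (simp add: f.add f.scale span_add span_scale)
  qed
  moreover have "f w - scale c w = f w' - scale c w'"
    using v by (simp add: w f.add scale_right_distrib)
  ultimately have "f w - scale c w \<in> span V"
    using w' by (simp add: span_diff span_scale)
  moreover have "f w - scale c w \<in> W"
    using insert.prems(1) W inv by (simp add: subspace_diff subspace_scale)
  ultimately have *: "f w - scale c w \<in> span VW"
    unfolding V_def VW_def using insert.IH by blast
  \<comment> \<open>As \<open>c \<notin> C\<close>, the map \<open>f - c\<close> is onto on the span of the eigenvectors for \<open>C\<close>.\<close>
  have "\<exists>z\<in>span VW. f z - scale c z = y" if "y \<in> span VW" for y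
    using that
  proof (induction rule: span_induct_alt)
    case base
    show ?case by (rule bexI[of _ 0]) (simp_all add: f.zero span_zero)
  next
    case (step a x y)
    from step obtain z where z: "z \<in> span VW" "f z - scale c z = y" by blast
    from step(1) obtain d where d: "d \<in> C" "f x = scale d x" by (auto simp: VW_def)
    with insert.hyps have "d - c \<noteq> 0" by auto
    have "f (scale (a / (d - c)) x) - scale c (scale (a / (d - c)) x)
        = scale (a / (d - c) * (d - c)) x"
      by (simp only: f.scale d(2) scale_scale scale_left_diff_distrib right_diff_distrib
          mult.commute[of c "a / (d - c)"])
    also have "\<dots> = scale a x" using \<open>d - c \<noteq> 0\<close> by simp
    finally have "f (scale (a / (d - c)) x) - scale c (scale (a / (d - c)) x) = scale a x" .
    with z have "f (scale (a / (d - c)) x + z) - scale c (scale (a / (d - c)) x + z)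
        = scale a x + y"
      by (simp only: f.add scale_right_distrib add_diff_add)
    moreover have "scale (a / (d - c)) x + z \<in> span VW"
      using z(1) step(1) by (simp add: span_add span_scale span_base)
    ultimately show ?case by blast
  qed
  with * obtain z where z: "z \<in> span VW" "f z - scale c z = f w - scale c w" by blast
  have sub: "VW \<subseteq> {v \<in> W. \<exists>c\<in>insert c C. f v = scale c v}"
    by (auto simp: VW_def)
  have "VW \<subseteq> W" by (auto simp: VW_def)
  with z(1) W have "z \<in> W" using span_minimal by blast
  then have "w - z \<in> W" using insert.prems(1) W by (simp add: subspace_diff)
  moreover have "f (w - z) = scale c (w - z)"
    using z(2) by (simp add: f.diff scale_right_diff_distrib algebra_simps)
  ultimately have "w - z \<in> span {v \<in> W. \<exists>c\<in>insert c C. f v = scale c v}"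
    by (intro span_base) auto
  moreover have "z \<in> span {v \<in> W. \<exists>c\<in>insert c C. f v = scale c v}"
    using z(1) span_mono[OF sub] by blast
  ultimately show ?case using span_add by fastforce
qed

text \<open>
  Induction on the number of maps: a common eigenvector \<open>v\<close> of the first ones lies in a joint
  eigenspace \<open>W\<close>, which the next map preserves because it commutes with them.  Splitting \<open>v\<close> into
  eigenvectors of that map inside \<open>W\<close> keeps the earlier eigenvalue equations.
\<close>

lemma span_common_eigenvectors:
  assumes "finite I" and fin: "finite D" "span D = UNIV"
    and "\<And>i. i \<in> I \<Longrightarrow> Vector_Spaces.linear scale scale (f i)"
    and "\<And>i j. i \<in> I \<Longrightarrow> j \<in> I \<Longrightarrow> f i \<circ> f j = f j \<circ> f i"
    and "\<And>i. i \<in> I \<Longrightarrow> local.diagonalizable (f i)"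
  shows "span {v. common_eigenvector scale I f v} = UNIV"
  using assms(1,4-6)
proof (induction I)
  case empty
  then show ?case by (simp add: common_eigenvector_def)
next
  case (insert g I)
  interpret g: Vector_Spaces.linear scale scale "f g" using insert.prems(1) by blast
  obtain B where B: "independent B" "span B = UNIV"
    and "\<forall>x\<in>B. \<exists>c. f g x = scale c x"
    using insert.prems(3) unfolding diagonalizable_def by blast
  then obtain e where e: "\<And>x. x \<in> B \<Longrightarrow> f g x = scale (e x) x" by metis
  have "finite B" using independent_span_bound[of D B] fin B by auto
  then have finC: "finite (e ` B)" by simp
  have "B \<subseteq> {v. \<exists>c\<in>e ` B. f g v = scale c v}" using e by auto
  then have spanC: "x \<in> span {v. \<exists>c\<in>e ` B. f g v = scale c v}" for x
    using B(2) span_mono by blast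
  have "v \<in> span {v. common_eigenvector scale (insert g I) f v}" if v: "common_eigenvector scale I f v" for v
  proof -
    obtain a where a: "\<And>i. i \<in> I \<Longrightarrow> f i v = scale (a i) v"
      using v unfolding common_eigenvector_def by metis
    define W where "W = {w. \<forall>i\<in>I. f i w = scale (a i) w}"
    have "subspace W"
    proof -
      have "f i 0 = 0" "f i (x + y) = f i x + f i y" "f i (scale c x) = scale c (f i x)"
        if "i \<in> I" for i x y c
      proof -
        interpret fi: Vector_Spaces.linear scale scale "f i" using insert.prems(1) that by blast
        show "f i 0 = 0" "f i (x + y) = f i x + f i y" "f i (scale c x) = scale c (f i x)"
          by (simp_all add: fi.zero fi.add fi.scale)
      qed
      then show ?thesis
        by (auto simp: W_def subspace_def scale_right_distrib mult.commute)
    qed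
    moreover have "f g w \<in> W" if "w \<in> W" for w
    proof -
      have "f i (f g w) = scale (a i) (f g w)" if "i \<in> I" for i
      proof -
        have "f i (f g w) = f g (f i w)"
          using insert.prems(2)[of i g] that by (metis comp_apply insertCI)
        also have "\<dots> = scale (a i) (f g w)"
          using \<open>w \<in> W\<close> that by (simp add: W_def g.scale)
        finally show ?thesis .
      qed
      then show ?thesis by (simp add: W_def)
    qed
    moreover have "v \<in> W" using a by (simp add: W_def)
    ultimately have "v \<in> span {v \<in> W. \<exists>c\<in>e ` B. f g v = scale c v}"
      using eigenspace_splitting[OF finC _ _ _ _ spanC] insert.prems(1) by blast
    moreover have "{v \<in> W. \<exists>c\<in>e ` B. f g v = scale c v} \<subseteq> {v. common_eigenvector scale (insert g I) f v}"
      by (auto simp: W_def common_eigenvector_def)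
    ultimately show ?thesis using span_mono by blast
  qed
  then have "span {v. common_eigenvector scale I f v} \<subseteq> span {v. common_eigenvector scale (insert g I) f v}"
    by (intro span_minimal) auto
  then show ?case using insert by auto
qed

end

section \<open>Orthogonal bases of common eigenvectors\<close>

locale symmetric_form_space = vector_space scale
  for scale :: "'f::field \<Rightarrow> 'u::ab_group_add \<Rightarrow> 'u" +
  fixes b :: "'u \<Rightarrow> 'u \<Rightarrow> 'f"
  assumes form: "local.symmetric_bilinear_form b"
    and nondeg: "local.nondegenerate b"
begin

lemma form_commute: "b u v = b v u"
  using form unfolding symmetric_bilinear_form_def by blast

lemma form_linear_right: "Vector_Spaces.linear scale (*) (b u)"
  using form unfolding symmetric_bilinear_form_def by blast

lemma form_add_right: "b u (v + w) = b u v + b u w"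
  and form_scale_right: "b u (scale c v) = c * b u v"
  and form_zero_right: "b u 0 = 0"
  and form_diff_right: "b u (v - w) = b u v - b u w"
  and form_sum_right: "b u (\<Sum>x\<in>X. g x) = (\<Sum>x\<in>X. b u (g x))"
proof -
  interpret b: Vector_Spaces.linear scale "(*)" "b u" by (fact form_linear_right)
  show "b u (v + w) = b u v + b u w" "b u (scale c v) = c * b u v" "b u 0 = 0"
    "b u (v - w) = b u v - b u w" "b u (\<Sum>x\<in>X. g x) = (\<Sum>x\<in>X. b u (g x))"
    by (simp_all add: b.add b.scale b.zero b.diff b.sum)
qed

lemma form_add_left: "b (v + w) u = b v u + b w u"
  and form_scale_left: "b (scale c v) u = c * b v u"
  and form_zero_left: "b 0 u = 0"
  using form_add_right form_scale_right form_zero_right by (metis form_commute)+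

lemma orthogonal_span:
  assumes "\<And>x. x \<in> X \<Longrightarrow> b u x = 0" and "v \<in> span X"
  shows "b u v = 0"
  using assms(2)
  by (induction rule: span_induct_alt)
    (simp_all add: form_zero_right form_add_right form_scale_right assms(1))

lemma orthogonal_imp_independent:
  assumes "\<And>x. x \<in> B \<Longrightarrow> b x x \<noteq> 0"
    and "\<And>x y. x \<in> B \<Longrightarrow> y \<in> B \<Longrightarrow> x \<noteq> y \<Longrightarrow> b x y = 0"
  shows "independent B"
proof
  assume "dependent B"
  then obtain x where x: "x \<in> B" "x \<in> span (B - {x})" unfolding dependent_def by blast
  then have "b x x = 0" using assms(2) by (intro orthogonal_span[OF _ x(2)]) auto
  with assms(1) x show False by blast
qed

lemma eigenvector_orthogonal:
  assumes "local.symmetric_rel b f" "f x = scale c x" "f y = scale d y" "b x y \<noteq> 0"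
  shows "c = d"
proof -
  have "c * b x y = b (f x) y" by (simp add: assms(2) form_scale_left)
  also have "\<dots> = b x (f y)" using assms(1) by (simp add: symmetric_rel_def)
  also have "\<dots> = d * b x y" by (simp add: assms(3) form_scale_right)
  finally show ?thesis using assms(4) by simp
qed

text \<open>
  The projection of \<open>s\<close> to the span of \<open>B\<close> involves only those \<open>x \<in> B\<close> with \<open>b x s \<noteq> 0\<close>, and
  these have the same eigenvalues as \<open>s\<close>.
\<close>

lemma common_eigenvector_orthogonal_part:
  assumes lin: "\<And>i. i \<in> I \<Longrightarrow> Vector_Spaces.linear scale scale (f i)"
    and sym: "\<And>i. i \<in> I \<Longrightarrow> local.symmetric_rel b (f i)"
    and "finite B"
    and an: "\<And>x. x \<in> B \<Longrightarrow> b x x \<noteq> 0"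
    and orth: "\<And>x y. x \<in> B \<Longrightarrow> y \<in> B \<Longrightarrow> x \<noteq> y \<Longrightarrow> b x y = 0"
    and ev: "\<And>x. x \<in> B \<Longrightarrow> common_eigenvector scale I f x"
    and s: "common_eigenvector scale I f s"
  shows "\<exists>p\<in>span B. common_eigenvector scale I f (s - p) \<and> (\<forall>x\<in>B. b x (s - p) = 0)"
proof -
  define p where "p = (\<Sum>x\<in>B. scale (b x s / b x x) x)"
  have "p \<in> span B" unfolding p_def by (intro span_sum span_scale span_base)
  moreover have "common_eigenvector scale I f (s - p)"
    unfolding common_eigenvector_def
  proof
    fix i assume i: "i \<in> I"
    interpret fi: Vector_Spaces.linear scale scale "f i" using lin i by blast
    obtain c where c: "f i s = scale c s"
      using s i unfolding common_eigenvector_def by blast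
    have "f i (scale (b x s / b x x) x) = scale c (scale (b x s / b x x) x)" if x: "x \<in> B" for x
    proof (cases "b x s = 0")
      case True
      then show ?thesis by (simp add: fi.zero)
    next
      case False
      obtain d where d: "f i x = scale d x"
        using ev[OF x] i unfolding common_eigenvector_def by blast
      have "d = c" using eigenvector_orthogonal[OF sym[OF i] d c False] .
      with d show ?thesis by (simp add: fi.scale mult.commute)
    qed
    then have "f i p = scale c p"
      unfolding p_def fi.sum scale_sum_right by (rule sum.cong[OF refl])
    with c have "f i (s - p) = scale c (s - p)" by (simp add: fi.diff scale_right_diff_distrib)
    then show "\<exists>c. f i (s - p) = scale c (s - p)" ..
  qed
  moreover have "b x (s - p) = 0" if x: "x \<in> B" for x
  proof -
    have "b x p = (\<Sum>y\<in>B. if y = x then b x s else 0)"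
      unfolding p_def form_sum_right form_scale_right
      by (rule sum.cong) (use an orth x in auto)
    also have "\<dots> = b x s" using x \<open>finite B\<close> by simp
    finally show ?thesis by (simp add: form_diff_right)
  qed
  ultimately show ?thesis by blast
qed

text \<open>
  If \<open>s\<close> and \<open>t\<close> are isotropic, then \<open>b (s + t) (s + t) = 2 * b s t\<close>.  The vector \<open>s + t\<close> is a
  common eigenvector, since \<open>b s t \<noteq> 0\<close> forces \<open>s\<close> and \<open>t\<close> to have the same eigenvalues.
\<close>

lemma anisotropic_common_eigenvector:
  assumes two: "(2::'f) \<noteq> 0"
    and lin: "\<And>i. i \<in> I \<Longrightarrow> Vector_Spaces.linear scale scale (f i)"
    and sym: "\<And>i. i \<in> I \<Longrightarrow> local.symmetric_rel b (f i)"
    and s: "common_eigenvector scale I f s" and t: "common_eigenvector scale I f t" and "b s t \<noteq> 0"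
  shows "\<exists>x\<in>{s, t, s + t}. common_eigenvector scale I f x \<and> b x x \<noteq> 0"
proof (cases "b s s = 0 \<and> b t t = 0")
  case True
  have "common_eigenvector scale I f (s + t)"
    unfolding common_eigenvector_def
  proof
    fix i assume i: "i \<in> I"
    interpret fi: Vector_Spaces.linear scale scale "f i" using lin i by blast
    obtain c d where c: "f i s = scale c s" and d: "f i t = scale d t"
      using s t i unfolding common_eigenvector_def by blast
    have "c = d" using eigenvector_orthogonal[OF sym[OF i] c d \<open>b s t \<noteq> 0\<close>] .
    with c d have "f i (s + t) = scale c (s + t)" by (simp add: fi.add scale_right_distrib)
    then show "\<exists>c. f i (s + t) = scale c (s + t)" ..
  qed
  moreover have "b (s + t) (s + t) = 2 * b s t"
    using True by (simp add: form_add_left form_add_right form_commute[of t s])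
  ultimately show ?thesis using two \<open>b s t \<noteq> 0\<close> by auto
next
  case False
  then show ?thesis using s t by blast
qed

text \<open>
  A largest orthogonal set of anisotropic common eigenvectors is a basis.  Such sets are bounded in
  size because anisotropy makes them independent.
\<close>

theorem orthogonal_basis_of_common_eigenvectors:
  assumes two: "(2::'f) \<noteq> 0"
    and "finite I" and fin: "finite D" "span D = UNIV"
    and lin: "\<And>i. i \<in> I \<Longrightarrow> Vector_Spaces.linear scale scale (f i)"
    and comm: "\<And>i j. i \<in> I \<Longrightarrow> j \<in> I \<Longrightarrow> f i \<circ> f j = f j \<circ> f i"
    and sym: "\<And>i. i \<in> I \<Longrightarrow> local.symmetric_rel b (f i)"
    and diag: "\<And>i. i \<in> I \<Longrightarrow> local.diagonalizable (f i)"
  obtains B where "independent B" "span B = UNIV"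
    "\<And>x. x \<in> B \<Longrightarrow> common_eigenvector scale I f x"
    "\<And>x y. x \<in> B \<Longrightarrow> y \<in> B \<Longrightarrow> x \<noteq> y \<Longrightarrow> b x y = 0"
proof -
  define Q where "Q B \<longleftrightarrow> (\<forall>x\<in>B. common_eigenvector scale I f x \<and> b x x \<noteq> 0) \<and>
    (\<forall>x\<in>B. \<forall>y\<in>B. x \<noteq> y \<longrightarrow> b x y = 0)" for B
  have ind: "independent B" if "Q B" for B
    using that unfolding Q_def by (intro orthogonal_imp_independent) blast+
  have bound: "finite B \<and> card B \<le> card D" if "Q B" for B
    using independent_span_bound[OF fin(1) ind[OF that]] fin(2) by simp
  have "Q {}" by (simp add: Q_def)
  then obtain B where B: "Q B" and max: "\<And>B'. Q B' \<Longrightarrow> card B' \<le> card B"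
    using ex_has_greatest_nat[of Q "{}" card "Suc (card D)"] bound by (metis le_imp_less_Suc)
  have ce: "span {v. common_eigenvector scale I f v} = UNIV"
    using span_common_eigenvectors assms by blast
  have part: "\<exists>p\<in>span B. common_eigenvector scale I f (s - p) \<and> (\<forall>x\<in>B. b x (s - p) = 0)"
    if "common_eigenvector scale I f s" for s
    using common_eigenvector_orthogonal_part[OF lin sym _ _ _ _ that, of B] bound[OF B] B
    unfolding Q_def by blast
  have "span B = UNIV"
  proof (rule ccontr)
    assume "span B \<noteq> UNIV"
    then have "\<not> {v. common_eigenvector scale I f v} \<subseteq> span B"
      using ce span_minimal[OF _ subspace_span] by blast
    then obtain s where s: "common_eigenvector scale I f s" "s \<notin> span B" by blast
    obtain p where p: "p \<in> span B" "common_eigenvector scale I f (s - p)" "\<forall>x\<in>B. b x (s - p) = 0"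
      using part[OF s(1)] by blast
    have "s - p \<noteq> 0" using s(2) p(1) by auto
    then obtain t where t: "common_eigenvector scale I f t" "b (s - p) t \<noteq> 0"
      using nondeg orthogonal_span[of "{v. common_eigenvector scale I f v}" "s - p"] ce
      unfolding nondegenerate_def by blast
    \<comment> \<open>Replacing \<open>t\<close> by its part orthogonal to \<open>B\<close> does not change its product with \<open>s - p\<close>.\<close>
    obtain q where q: "q \<in> span B" "common_eigenvector scale I f (t - q)" "\<forall>x\<in>B. b x (t - q) = 0"
      using part[OF t(1)] by blast
    have "b (s - p) q = 0"
      using p(3) form_commute by (intro orthogonal_span[OF _ q(1)]) metis
    with t(2) have "b (s - p) (t - q) \<noteq> 0" by (simp add: form_diff_right)
    then obtain x where x: "x \<in> {s - p, t - q, (s - p) + (t - q)}"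
      "common_eigenvector scale I f x" "b x x \<noteq> 0"
      using anisotropic_common_eigenvector[OF two lin sym p(2) q(2)] by blast
    have xB: "b y x = 0" if "y \<in> B" for y
      using x(1) p(3) q(3) that by (auto simp: form_add_right)
    with x(3) have "x \<notin> B" by blast
    moreover have "Q (insert x B)"
      using B x(2,3) xB form_commute unfolding Q_def by (metis insert_iff)
    ultimately show False using max[of "insert x B"] bound[OF B] by simp
  qed
  then show ?thesis using that[of B] ind[OF B] B unfolding Q_def by blast
qed

end

section \<open>Bases of coordinate subspaces\<close>

definition unit_vector :: "nat \<Rightarrow> 'u::zero \<times> (nat \<Rightarrow> 'f::{zero,one})" where
  "unit_vector i = (0, \<lambda>j. if j = i then 1 else 0)"

definition coordinate_basis :: "'u set \<Rightarrow> nat set \<Rightarrow> ('u::zero \<times> (nat \<Rightarrow> 'f::{zero,one})) set" where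
  "coordinate_basis B I = (\<lambda>u. (u, 0)) ` B \<union> unit_vector ` I"

context vector_space
begin

lemma vector_space_E_scale: "vector_space (E_scale scale)"
  by standard (auto simp: E_scale_def fun_eq_iff scale_right_distrib scale_left_distrib algebra_simps)

interpretation E: vector_space "E_scale scale" by (fact vector_space_E_scale)

lemma independent_span_coordinate_basis:
  assumes "independent B" and "finite I"
  shows "E.independent (coordinate_basis B I) \<and>
    E.span (coordinate_basis B I) = {(u, \<alpha>). u \<in> span B \<and> (\<forall>i. i \<notin> I \<longrightarrow> \<alpha> i = 0)}"
  using assms(2)
proof (induction I)
  case empty
  interpret incl: Vector_Spaces.linear scale "E_scale scale" "\<lambda>u. (u, 0)"
    by (unfold_locales) (auto simp: E_scale_def fun_eq_iff)
  have "inj_on (\<lambda>u. (u, 0 :: nat \<Rightarrow> 'a)) (span B)" by (simp add: inj_on_def)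
  then have "E.independent ((\<lambda>u. (u, 0)) ` B)"
    using incl.independent_injective_image[OF assms(1)] by blast
  moreover have "E.span ((\<lambda>u. (u, 0)) ` B) = (\<lambda>u. (u, 0)) ` span B"
    by (rule incl.span_image)
  moreover have "(\<lambda>u. (u, 0)) ` span B = {(u, \<alpha>). u \<in> span B \<and> (\<forall>i. \<alpha> i = 0)}"
    by (auto simp: fun_eq_iff image_iff)
  ultimately show ?case by (simp add: coordinate_basis_def)
next
  case (insert i I)
  let ?e = "unit_vector i :: 'b \<times> (nat \<Rightarrow> 'a)"
  have eq: "coordinate_basis B (insert i I) = insert ?e (coordinate_basis B I)"
    by (auto simp: coordinate_basis_def)
  have "?e \<notin> E.span (coordinate_basis B I)"
    using insert by (auto simp: unit_vector_def)
  moreover have "E.span (insert ?e (coordinate_basis B I)) =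
      {(u, \<alpha>). u \<in> span B \<and> (\<forall>j. j \<notin> insert i I \<longrightarrow> \<alpha> j = 0)}" (is "?L = ?R")
  proof (intro set_eqI iffI)
    fix x assume "x \<in> ?L"
    then obtain c where "x - E_scale scale c ?e \<in> E.span (coordinate_basis B I)"
      using E.span_insert by blast
    then show "x \<in> ?R" using insert
      by (cases x) (force simp: unit_vector_def E_scale_def)
  next
    fix x assume x: "x \<in> ?R"
    have "x - E_scale scale (snd x i) ?e = (fst x, \<lambda>j. if j = i then 0 else snd x j)"
      by (auto simp: unit_vector_def E_scale_def split_beta fun_eq_iff prod_eq_iff)
    then have "x - E_scale scale (snd x i) ?e \<in> E.span (coordinate_basis B I)"
      using x insert by auto
    then show "x \<in> ?L" unfolding E.span_insert by blast
  qed
  ultimately show ?case using insert eq by (simp add: E.independent_insert)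
qed

lemmas independent_coordinate_basis = independent_span_coordinate_basis[THEN conjunct1]
  and span_coordinate_basis = independent_span_coordinate_basis[THEN conjunct2]

lemma finite_coordinate_basis:
  "finite B \<Longrightarrow> finite I \<Longrightarrow> finite (coordinate_basis B I)"
  by (simp add: coordinate_basis_def)

lemma card_coordinate_basis:
  assumes "finite B" "finite I"
  shows "card (coordinate_basis B I :: ('b \<times> (nat \<Rightarrow> 'a)) set) = card B + card I"
proof -
  have "inj_on (unit_vector :: nat \<Rightarrow> 'b \<times> (nat \<Rightarrow> 'a)) I"
    by (auto simp: inj_on_def unit_vector_def fun_eq_iff split: if_splits)
  moreover have "inj_on (\<lambda>u. (u, 0 :: nat \<Rightarrow> 'a)) B" by (simp add: inj_on_def)
  moreover have "(\<lambda>u. (u, 0)) ` B \<inter> (unit_vector ` I :: ('b \<times> (nat \<Rightarrow> 'a)) set) = {}"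
    by (auto simp: unit_vector_def fun_eq_iff split: if_splits dest: spec)
  ultimately show ?thesis
    using assms by (simp add: coordinate_basis_def card_Un_disjoint card_image)
qed

lemma dim_coordinate_subspace:
  assumes "independent B" "finite B" "finite I"
  shows "E.dim {(u, \<alpha>). u \<in> span B \<and> (\<forall>i. i \<notin> I \<longrightarrow> \<alpha> i = 0)} = card B + card I"
  using E.dim_span_eq_card_independent[OF independent_coordinate_basis[OF assms(1,3)]]
    span_coordinate_basis[OF assms(1,3)] card_coordinate_basis[OF assms(2,3)] by simp

end

section \<open>The upper annihilating series through ideals\<close>

context nonassoc_algebra
begin

definition is_ideal :: "'b set \<Rightarrow> bool" where
  "is_ideal I \<longleftrightarrow> local.subspace I \<and> I \<subseteq> A \<and> (\<forall>x\<in>A. \<forall>y\<in>I. x \<cdot> y \<in> I \<and> y \<cdot> x \<in> I)"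

lemma coset_eq_iff:
  assumes "local.subspace I" shows "x +o I = y +o I \<longleftrightarrow> x - y \<in> I"
proof
  assume "x +o I = y +o I"
  then have "x \<in> y +o I"
    using set_plus_intro2[OF subspace_0[OF assms], of x] by simp
  then show "x - y \<in> I" by (auto simp: elt_set_plus_def)
next
  assume d: "x - y \<in> I"
  show "x +o I = y +o I"
  proof (rule set_eqI)
    fix z
    have "z \<in> x +o I \<longleftrightarrow> z - x \<in> I" for x
      by (auto simp: elt_set_plus_def intro: bexI[of _ "z - x"])
    moreover have "z - x \<in> I \<longleftrightarrow> z - y \<in> I"
      using subspace_add[OF assms _ d, of "z - x"] subspace_diff[OF assms _ d, of "z - y"]
      by auto
    ultimately show "z \<in> x +o I \<longleftrightarrow> z \<in> y +o I" by simp
  qed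
qed

text \<open>
  The quotient product is the union of all cosets \<open>(x \<cdot> y) +o I\<close> over the representatives.  For an
  ideal these cosets coincide.
\<close>

lemma quotient_mult_cosets:
  assumes "is_ideal I" "x \<in> A" "y \<in> A"
  shows "quotient_mult I (x +o I) (y +o I) = (x \<cdot> y) +o I"
proof -
  have I: "local.subspace I" "I \<subseteq> A" using assms by (auto simp: is_ideal_def)
  have coset: "((x + i) \<cdot> (y + j)) +o I = (x \<cdot> y) +o I" if "i \<in> I" "j \<in> I" for i j
  proof -
    have ij: "i \<in> A" "j \<in> A" using that I by auto
    have "x \<cdot> j + (i \<cdot> y + i \<cdot> j) \<in> I"
      using assms that ij by (intro subspace_add I) (auto simp: is_ideal_def)
    moreover have "(x + i) \<cdot> (y + j) - x \<cdot> y = x \<cdot> j + (i \<cdot> y + i \<cdot> j)"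
      using assms ij subspace_add[OF subspace_carrier]
      by (simp add: mult_add_left mult_add_right)
    ultimately show ?thesis by (simp add: coset_eq_iff[OF I(1)])
  qed
  have "quotient_mult I (x +o I) (y +o I) = (\<Union>i\<in>I. \<Union>j\<in>I. ((x + i) \<cdot> (y + j)) +o I)"
    by (auto simp: quotient_mult_def elt_set_plus_def)
  also have "\<dots> = (\<Union>i\<in>I. \<Union>j\<in>I. (x \<cdot> y) +o I)" using coset by simp
  also have "\<dots> = (x \<cdot> y) +o I" using subspace_0[OF I(1)] by auto
  finally show ?thesis .
qed

lemma ann_series_Suc_ideal:
  assumes "is_ideal (ann_series i)"
  shows "ann_series (Suc i) =
    {x \<in> A. \<forall>y\<in>A. x \<cdot> y \<in> ann_series i \<and> y \<cdot> x \<in> ann_series i}"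
proof -
  have "local.subspace (ann_series i)" using assms by (simp add: is_ideal_def)
  from coset_eq_iff[OF this, of _ 0]
  have coset_zero: "x +o ann_series i = ann_series i \<longleftrightarrow> x \<in> ann_series i" for x
    by simp
  have "x +o ann_series i \<in>
      annihilator (quotient_carrier (ann_series i)) (quotient_mult (ann_series i)) (ann_series i)
    \<longleftrightarrow> (\<forall>y\<in>A. x \<cdot> y \<in> ann_series i \<and> y \<cdot> x \<in> ann_series i)" if "x \<in> A" for x
    using that
    by (simp add: annihilator_def quotient_carrier_def quotient_mult_cosets[OF assms] coset_zero)
  then show ?thesis by (simp only: ann_series.simps cong: conj_cong)
qed

lemma is_ideal_ann_series: "is_ideal (ann_series i)"
proof (induction i)
  case 0
  have "x \<cdot> 0 = 0" "0 \<cdot> x = 0" if "x \<in> A" for x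
    using mult_add_left[of 0 0 x] mult_add_right[of x 0 0] that subspace_0[OF subspace_carrier]
    by auto
  then show ?case
    using subspace_0[OF subspace_carrier] by (auto simp: is_ideal_def subspace_def)
next
  case (Suc i)
  let ?I = "ann_series i"
  have I: "local.subspace ?I" "?I \<subseteq> A" "\<And>x y. x \<in> A \<Longrightarrow> y \<in> ?I \<Longrightarrow> x \<cdot> y \<in> ?I \<and> y \<cdot> x \<in> ?I"
    using Suc by (auto simp: is_ideal_def)
  have zero: "0 \<cdot> y \<in> ?I \<and> y \<cdot> 0 \<in> ?I" if "y \<in> A" for y
    using I(3)[OF that subspace_0[OF I(1)]] by simp
  have "local.subspace (ann_series (Suc i))"
    unfolding ann_series_Suc_ideal[OF Suc]
    using I(1) subspace_carrier zero
    by (auto simp: subspace_def mult_add_left mult_add_right mult_scale_left mult_scale_right)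
  moreover have "?I \<subseteq> ann_series (Suc i)"
    unfolding ann_series_Suc_ideal[OF Suc] using I by blast
  ultimately show ?case
    unfolding is_ideal_def ann_series_Suc_ideal[OF Suc] by blast
qed

lemmas ann_series_Suc_eq = ann_series_Suc_ideal[OF is_ideal_ann_series]

text \<open>
  A multiplicative filtration by subspaces bounds the powers from above.  In this way estimates of
  the powers reduce to products of two elements.
\<close>

lemma algebra_power_subset:
  assumes "A \<subseteq> G 1"
    and sub: "\<And>m. local.subspace (G m)"
    and prod: "\<And>p q x y. 1 \<le> p \<Longrightarrow> 1 \<le> q \<Longrightarrow> x \<in> G p \<Longrightarrow> y \<in> G q \<Longrightarrow> x \<cdot> y \<in> G (p + q)"
    and "1 \<le> m"
  shows "algebra_power m \<subseteq> G m"
  using \<open>1 \<le> m\<close>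
proof (induction m rule: less_induct)
  case (less m)
  show ?case
  proof (cases "m = 1")
    case True
    then show ?thesis using assms(1) by (simp add: algebra_power.simps)
  next
    case False
    have summand: "subspace_prod (algebra_power i) (algebra_power (m - i)) \<subseteq> G m"
      (is "?P i \<subseteq> _") if "i \<in> {1..m - 1}" for i
      unfolding subspace_prod_def
    proof (intro span_minimal sub subsetI)
      fix z assume "z \<in> {x \<cdot> y |x y. x \<in> algebra_power i \<and> y \<in> algebra_power (m - i)}"
      then obtain x y where "z = x \<cdot> y" "x \<in> algebra_power i" "y \<in> algebra_power (m - i)" by blast
      moreover have "algebra_power i \<subseteq> G i" "algebra_power (m - i) \<subseteq> G (m - i)"
        using that by (intro less.IH; force)+
      ultimately show "z \<in> G m" using prod[of i "m - i" x y] that less.prems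
        by (auto simp: subset_iff)
    qed
    have sum_subset: "(\<Sum>i\<in>J. X i) \<subseteq> G m" if "finite J" "\<And>i. i \<in> J \<Longrightarrow> X i \<subseteq> G m"
      for J :: "nat set" and X
      using that
    proof (induction J)
      case empty
      then show ?case using subspace_0[OF sub] by auto
    next
      case (insert i J)
      have "X i + (\<Sum>i\<in>J. X i) \<subseteq> G m + G m"
        using insert by (intro set_plus_mono2) auto
      also have "\<dots> \<subseteq> G m" using subspace_add[OF sub] by (auto simp: set_plus_def)
      finally show ?case using insert by simp
    qed
    have "(\<Sum>i = 1..m - 1. ?P i) \<subseteq> G m"
      by (rule sum_subset) (rule finite_atLeastAtMost, erule summand)
    moreover have "algebra_power m = (\<Sum>i = 1..m - 1. ?P i)"
      using False less.prems by (subst algebra_power.simps) simp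
    ultimately show ?thesis by simp
  qed
qed

lemma zero_in_algebra_power: "0 \<in> algebra_power m"
proof (cases "m \<le> 1")
  case True
  then show ?thesis using subspace_0[OF subspace_carrier] by (simp add: algebra_power.simps)
next
  case False
  have "0 \<in> (\<Sum>i\<in>J. subspace_prod (X i) (Y i))" if "finite J" for J :: "nat set" and X Y
    using that
  proof induction
    case (insert i J)
    have "0 \<in> subspace_prod (X i) (Y i)" by (simp add: subspace_prod_def span_zero)
    from set_plus_intro[OF this insert.IH] show ?case using insert.hyps by simp
  qed simp
  then show ?thesis using False by (subst algebra_power.simps) auto
qed

end

section \<open>The algebra of a form and its symmetric endomorphisms\<close>

locale E_algebra = symmetric_form_space scale b
  for scale :: "'f::field \<Rightarrow> 'u::ab_group_add \<Rightarrow> 'u" and b +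
  fixes k :: nat and f :: "nat \<Rightarrow> 'u \<Rightarrow> 'u"
  assumes k_ge_1: "1 \<le> k"
    and f_linear: "\<And>i. i \<in> {1..k - 1} \<Longrightarrow> Vector_Spaces.linear scale scale (f i)"
begin

text \<open>The indices are shifted in the way in which \<open>f\<close> enters the product.\<close>

lemma f_add:
    "2 \<le> i \<Longrightarrow> i \<le> k \<Longrightarrow> f (i - Suc 0) (u + v) = f (i - Suc 0) u + f (i - Suc 0) v"
  and f_scale: "2 \<le> i \<Longrightarrow> i \<le> k \<Longrightarrow> f (i - Suc 0) (scale c u) = scale c (f (i - Suc 0) u)"
  and f_zero: "2 \<le> i \<Longrightarrow> i \<le> k \<Longrightarrow> f (i - Suc 0) 0 = 0"
proof -
  assume "2 \<le> i" "i \<le> k"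
  then have "i - Suc 0 \<in> {1..k - 1}" by auto
  then interpret fi: Vector_Spaces.linear scale scale "f (i - Suc 0)" by (rule f_linear)
  show "f (i - Suc 0) (u + v) = f (i - Suc 0) u + f (i - Suc 0) v"
    "f (i - Suc 0) (scale c u) = scale c (f (i - Suc 0) u)" "f (i - Suc 0) 0 = 0"
    by (simp_all add: fi.add fi.scale fi.zero)
qed

sublocale alg: nonassoc_algebra "E_scale scale" "E_carrier k" "E_mult k b f"
proof -
  interpret E: vector_space "E_scale scale" by (fact vector_space_E_scale)
  show "nonassoc_algebra (E_scale scale) (E_carrier k) (E_mult k b f)"
  proof
    show "E.subspace (E_carrier k)"
      by (auto simp: E.subspace_def E_carrier_def E_scale_def zero_prod_def)
  qed (use k_ge_1 in \<open>auto simp: E_carrier_def E_mult_def E_scale_def fun_eq_iff f_add f_scale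
      form_add_left form_add_right form_scale_left form_scale_right algebra_simps\<close>)
qed

text \<open>
  This shows that the elements satisfying the condition on \<open>x\<close> for \<open>p\<close> contain \<open>E\<^sup>p\<close>.
  In coordinate \<open>i\<close> of the product, a nonzero term from \<open>b\<close> requires \<open>p = q = 1\<close>, and a nonzero
  term from coordinates \<open>i - 1\<close> requires \<open>p, q \<le> 2\<^sup>i\<^sup>-\<^sup>1\<close>; in both cases \<open>p + q \<le> 2\<^sup>i\<close>.
\<close>

lemma mult_power_filtration:
  fixes p q :: nat
  assumes "1 \<le> p" "1 \<le> q"
    and x: "2 \<le> p \<Longrightarrow> fst x = 0" "\<And>i. 2 ^ i < p \<Longrightarrow> snd x i = 0"
    and y: "2 \<le> q \<Longrightarrow> fst y = 0" "\<And>i. 2 ^ i < q \<Longrightarrow> snd y i = 0"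
    and i: "2 ^ i < p + q"
  shows "snd (E_mult k b f x y) i = 0"
proof -
  have b0: "b (h (fst x)) (fst y) = 0" if "1 \<le> i" "h 0 = 0" for h
  proof -
    have "(2::nat) ^ 1 \<le> 2 ^ i" using that(1) by (intro power_increasing) auto
    with i have "2 \<le> p \<or> 2 \<le> q" by auto
    then show ?thesis using x(1) y(1) that(2) by (auto simp: form_zero_left form_zero_right)
  qed
  have "snd x (i - 1) * snd y (i - 1) = 0" if "2 \<le> i"
  proof -
    have "(2::nat) ^ i = 2 ^ (i - 1) + 2 ^ (i - 1)"
      using that by (cases i) auto
    with i have "2 ^ (i - 1) < p \<or> 2 ^ (i - 1) < q" by linarith
    then show ?thesis using x(2) y(2) by auto
  qed
  then show ?thesis
    using b0[of id] b0[of "f (i - 1)"] f_zero[of i]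
    by (auto simp: E_mult_def split_beta)
qed

theorem nilpotent: "alg.nilpotent"
proof -
  \<comment> \<open>Coordinate \<open>0\<close> is excluded here, as it vanishes on the carrier.\<close>
  define G :: "nat \<Rightarrow> ('u \<times> (nat \<Rightarrow> 'f)) set" where
    "G m = {x \<in> E_carrier k. (2 \<le> m \<longrightarrow> fst x = 0) \<and> (\<forall>i\<ge>1. 2 ^ i < m \<longrightarrow> snd x i = 0)}" for m
  have "alg.algebra_power (2 ^ k + 1) \<subseteq> G (2 ^ k + 1)"
  proof (rule alg.algebra_power_subset)
    show "E_carrier k \<subseteq> G 1" by (auto simp: G_def)
    show "alg.subspace (G m)" for m
      by (auto simp: G_def alg.subspace_def E_carrier_def E_scale_def zero_prod_def)
    show "E_mult k b f x y \<in> G (p + q)"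
      if pq: "1 \<le> p" "1 \<le> q" and "x \<in> G p" "y \<in> G q" for p q x y
    proof -
      have xy: "x \<in> E_carrier k" "y \<in> E_carrier k" using that by (auto simp: G_def)
      then have "snd x 0 = 0" "snd y 0 = 0" by (auto simp: E_carrier_def)
      with that have "2 ^ i < p \<Longrightarrow> snd x i = 0" "2 ^ i < q \<Longrightarrow> snd y i = 0" for i
        by (cases "i = 0"; auto simp: G_def)+
      then have "snd (E_mult k b f x y) i = 0" if "2 ^ i < p + q" for i
        using mult_power_filtration[OF pq, of x y i] that \<open>x \<in> G p\<close> \<open>y \<in> G q\<close> by (auto simp: G_def)
      moreover have "fst (E_mult k b f x y) = 0" by (simp add: E_mult_def split_beta)
      ultimately show ?thesis using alg.mult_closed[OF xy] by (simp add: G_def)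
    qed
  qed simp
  moreover have "G (2 ^ k + 1) \<subseteq> {0}"
  proof
    fix x assume x: "x \<in> G (2 ^ k + 1)"
    have "snd x i = 0" for i
    proof (cases "i \<in> {1..k}")
      case True
      then have "(2::nat) ^ i < 2 ^ k + 1" by (simp add: le_imp_less_Suc)
      then show ?thesis using x True by (simp add: G_def)
    next
      case False
      then show ?thesis using x by (auto simp: G_def E_carrier_def)
    qed
    moreover have "fst x = 0" using x by (auto simp: G_def)
    ultimately show "x \<in> {0}" by (simp add: prod_eq_iff fun_eq_iff)
  qed
  ultimately have "alg.algebra_power (2 ^ k + 1) = {0}"
    using alg.zero_in_algebra_power by blast
  then show ?thesis unfolding alg.nilpotent_def by (intro exI[of _ "2 ^ k + 1"]) simp
qed

text \<open>
  Each step of the series gains exactly one more unit vector.  Of the products with \<open>x\<close>, coordinate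
  \<open>1\<close> of that with \<open>(v, 0)\<close> is \<open>b (fst x) v\<close>, and coordinate \<open>i + 1\<close> of that with the \<open>i\<close>-th
  unit vector is coordinate \<open>i\<close> of \<open>x\<close>; these test elements give all conditions.
\<close>

lemma ann_series_E:
  assumes "j \<le> k"
  shows "alg.ann_series j = {(u, \<alpha>). u = 0 \<and> (\<forall>i. i \<notin> {k - j<..k} \<longrightarrow> \<alpha> i = 0)}"
  using assms
proof (induction j)
  case 0
  then show ?case by (auto simp: fun_eq_iff zero_prod_def)
next
  case (Suc j)
  have IH: "alg.ann_series j = {(u, \<alpha>). u = 0 \<and> (\<forall>i. i \<notin> {k - j<..k} \<longrightarrow> \<alpha> i = 0)}"
    using Suc by simp
  show ?case
  proof (intro set_eqI iffI)
    fix x assume "x \<in> alg.ann_series (Suc j)"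
    then have x: "x \<in> E_carrier k"
      and ann: "\<And>y i. y \<in> E_carrier k \<Longrightarrow> i \<notin> {k - j<..k} \<Longrightarrow> snd (E_mult k b f x y) i = 0"
      unfolding alg.ann_series_Suc_eq IH by auto
    have "b (fst x) v = 0" for v
      using ann[of "(v, 0)" 1] Suc.prems by (auto simp: E_carrier_def E_mult_def split_beta)
    then have "fst x = 0" using nondeg unfolding nondegenerate_def by blast
    moreover have "snd x i = 0" if "i \<notin> {k - Suc j<..k}" for i
    proof (cases "i \<in> {1..k}")
      case True
      then have i: "Suc i \<in> {2..k}" "Suc i \<notin> {k - j<..k}" using that Suc.prems by auto
      then show ?thesis
        using ann[of "unit_vector i" "Suc i"] True
        by (auto simp: E_carrier_def E_mult_def split_beta unit_vector_def form_zero_right)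
    next
      case False
      then show ?thesis using x by (auto simp: E_carrier_def)
    qed
    ultimately show "x \<in> {(u, \<alpha>). u = 0 \<and> (\<forall>i. i \<notin> {k - Suc j<..k} \<longrightarrow> \<alpha> i = 0)}"
      by (cases x) simp
  next
    fix x :: "'u \<times> (nat \<Rightarrow> 'f)"
    assume "x \<in> {(u, \<alpha>). u = 0 \<and> (\<forall>i. i \<notin> {k - Suc j<..k} \<longrightarrow> \<alpha> i = 0)}"
    then have x: "fst x = 0" "\<And>i. i \<notin> {k - Suc j<..k} \<Longrightarrow> snd x i = 0" by auto
    then have "x \<in> E_carrier k" by (auto simp: E_carrier_def split_beta)
    moreover have "E_mult k b f x y \<in> alg.ann_series j \<and> E_mult k b f y x \<in> alg.ann_series j" for y
      unfolding IH using x Suc.prems f_zero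
      by (auto simp: E_mult_def split_beta form_zero_left form_zero_right)
    ultimately show "x \<in> alg.ann_series (Suc j)"
      unfolding alg.ann_series_Suc_eq by blast
  qed
qed

lemma ann_series_E_top: "alg.ann_series (Suc k) = E_carrier k"
proof -
  have "E_mult k b f x y \<in> alg.ann_series k" for x y
    unfolding ann_series_E[OF order.refl] using k_ge_1 by (auto simp: E_mult_def split_beta)
  then show ?thesis unfolding alg.ann_series_Suc_eq by blast
qed

theorem evolution_algebra_of_orthogonal_eigenbasis:
  assumes "independent B" "span B = UNIV"
    and ev: "\<And>x. x \<in> B \<Longrightarrow> common_eigenvector scale {1..k - 1} f x"
    and orth: "\<And>x y. x \<in> B \<Longrightarrow> y \<in> B \<Longrightarrow> x \<noteq> y \<Longrightarrow> b x y = 0"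
  shows "evolution_algebra (E_scale scale) (E_carrier k) (E_mult k b f)"
proof
  let ?B = "coordinate_basis B {1..k} :: ('u \<times> (nat \<Rightarrow> 'f)) set"
  have "alg.independent ?B" and "alg.span ?B = E_carrier k"
    using independent_coordinate_basis[OF assms(1)] span_coordinate_basis[OF assms(1)] assms(2)
    by (auto simp: E_carrier_def)
  moreover have "E_mult k b f x y = 0" if "x \<in> ?B" "y \<in> ?B" "x \<noteq> y" for x y
  proof -
    have fb: "b (f (i - Suc 0) u) v = 0" if "u \<in> B" "v \<in> B" "u \<noteq> v" "2 \<le> i" "i \<le> k" for u v i
    proof -
      have "i - Suc 0 \<in> {1..k - 1}" using that by auto
      then obtain c where "f (i - Suc 0) u = scale c u"
        using ev[OF \<open>u \<in> B\<close>] unfolding common_eigenvector_def by blast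
      then show ?thesis using orth that by (simp add: form_scale_left)
    qed
    show ?thesis
      using that orth fb f_zero
      by (auto simp: coordinate_basis_def unit_vector_def E_mult_def zero_prod_def fun_eq_iff
          form_zero_left form_zero_right)
  qed
  ultimately show "\<exists>B. alg.independent B \<and> alg.span B = E_carrier k \<and>
      (\<forall>x\<in>B. \<forall>y\<in>B. x \<noteq> y \<longrightarrow> E_mult k b f x y = 0)" by blast
qed

theorem has_type:
  assumes B: "independent B" "span B = UNIV" "finite B" and "B \<noteq> {}"
  shows "alg.has_type (replicate k 1 @ [card B])"
proof -
  have E: "E_carrier k = {(u, \<alpha>). u \<in> span B \<and> (\<forall>i. i \<notin> {1..k} \<longrightarrow> \<alpha> i = 0)}"
    using B(2) by (auto simp: E_carrier_def)
  have "alg.span (coordinate_basis B {1..k}) = E_carrier k"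
    using span_coordinate_basis[OF B(1), of "{1..k}"] by (simp only: E) simp
  then have fd: "alg.finite_dimensional"
    unfolding alg.finite_dimensional_def
    using finite_coordinate_basis[OF B(3), of "{1..k}"] by blast
  have dim: "alg.dim (alg.ann_series j) = j" if "j \<le> k" for j
    using dim_coordinate_subspace[of "{}" "{k - j<..k}"] that
    by (simp add: ann_series_E independent_empty span_empty)
  have dim_top: "alg.dim (E_carrier k) = card B + k"
    using dim_coordinate_subspace[OF B(1,3), of "{1..k}"] by (simp add: E)
  have "card B > 0" using assms by (simp add: card_gt_0_iff)
  have proper: "alg.ann_series t \<noteq> E_carrier k" if "t < Suc k" for t
  proof
    assume "alg.ann_series t = E_carrier k"
    with dim[of t] dim_top that have "t = card B + k" by simp
    with that \<open>card B > 0\<close> show False by simp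
  qed
  have "map (\<lambda>i. alg.dim (alg.ann_series i) - alg.dim (alg.ann_series (i - 1))) [1..<Suc (Suc k)]
      = replicate k 1 @ [card B]"
  proof -
    have "alg.dim (alg.ann_series i) - alg.dim (alg.ann_series (i - 1)) = 1"
      if "i \<in> {1..<Suc k}" for i
    proof -
      have "1 \<le> i" "i \<le> k" "i - 1 \<le> k" using that by auto
      then show ?thesis by (simp only: dim)
    qed
    then have "map (\<lambda>i. alg.dim (alg.ann_series i) - alg.dim (alg.ann_series (i - 1))) [1..<Suc k]
        = map (\<lambda>_. 1) [1..<Suc k]"
      by (intro map_cong) (simp_all only: set_upt)
    then show ?thesis
      by (simp add: map_replicate_const ann_series_E_top dim dim_top del: alg.ann_series.simps)
  qed
  from this[symmetric] show ?thesis
    unfolding alg.has_type_def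
    by (intro conjI fd nilpotent exI[of _ "Suc k"] ann_series_E_top allI impI proper)
qed

end

theorem proposition1:
  fixes scale :: "'f::field \<Rightarrow> 'u::ab_group_add \<Rightarrow> 'u"
    and b :: "'u \<Rightarrow> 'u \<Rightarrow> 'f"
    and f :: "nat \<Rightarrow> 'u \<Rightarrow> 'u"
    and k n :: nat
  assumes "CHAR('f) \<noteq> 2"
    and "k \<ge> 1"
    and "vector_space scale"
    and "n \<ge> 1"
    and "vector_space.dim scale (UNIV :: 'u set) = n"
    and "vector_space.symmetric_bilinear_form scale b"
    and "vector_space.nondegenerate b"
    and "\<And>i. i \<in> {1..k - 1} \<Longrightarrow> Vector_Spaces.linear scale scale (f i)"
    and "\<And>i j. i \<in> {1..k - 1} \<Longrightarrow> j \<in> {1..k - 1} \<Longrightarrow> f i \<circ> f j = f j \<circ> f i"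
    and "\<And>i. i \<in> {1..k - 1} \<Longrightarrow> vector_space.symmetric_rel b (f i)"
    and "\<And>i. i \<in> {1..k - 1} \<Longrightarrow> vector_space.diagonalizable scale (f i)"
  shows "evolution_algebra (E_scale scale) (E_carrier k) (E_mult k b f)
    \<and> nonassoc_algebra.nilpotent (E_scale scale) (E_carrier k) (E_mult k b f)
    \<and> nonassoc_algebra.has_type (E_scale scale) (E_carrier k) (E_mult k b f)
        (replicate k 1 @ [n])"
proof -
  interpret vector_space scale by fact
  obtain D where D: "independent D" "span D = UNIV" "card D = n"
    using basis_exists[of UNIV] \<open>dim UNIV = n\<close> by (metis UNIV_I subsetI subset_antisym)
  then have "finite D" using \<open>n \<ge> 1\<close> by (metis card.infinite not_one_le_zero)
  interpret E_algebra scale b k f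
    by (intro E_algebra.intro symmetric_form_space.intro symmetric_form_space_axioms.intro
        E_algebra_axioms.intro) (fact assms)+
  have "(2::'f) \<noteq> 0"
  proof
    assume "(2::'f) = 0"
    then have "CHAR('f) dvd 2" using of_nat_eq_0_iff_char_dvd[of 2, where 'a = 'f] by simp
    then have "CHAR('f) \<le> 2" "CHAR('f) \<noteq> 0"
      by (auto dest: dvd_imp_le intro!: Nat.gr0I)
    then show False using \<open>CHAR('f) \<noteq> 2\<close> CHAR_not_1'[where 'a = 'f] by linarith
  qed
  then obtain B where B: "independent B" "span B = UNIV"
    "\<And>x. x \<in> B \<Longrightarrow> common_eigenvector scale {1..k - 1} f x"
    "\<And>x y. x \<in> B \<Longrightarrow> y \<in> B \<Longrightarrow> x \<noteq> y \<Longrightarrow> b x y = 0"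
    using orthogonal_basis_of_common_eigenvectors[of "{1..k - 1}" D f] \<open>finite D\<close> D(2) assms(8-11)
    by blast
  have "D \<noteq> {}" using D(3) \<open>n \<ge> 1\<close> by auto
  then have "alg.has_type (replicate k 1 @ [n])"
    using has_type[OF D(1,2) \<open>finite D\<close>] D(3) by simp
  with nilpotent evolution_algebra_of_orthogonal_eigenbasis[OF B] show ?thesis by blast
qed

end
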